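(* An $(n+1)$-maniplex $\mathcal M$ is isomorphic to $\mathcal K^{\xi}$ for some canonical Cayley extender $(\mathcal K,\xi)$ if and only if there is a subgroup $G\le\Gamma(\mathcal M)$ acting regularly on the facets of $\mathcal M$ such that for every flag $\Phi$ of $\mathcal M$ there is $\gamma\in G$ with $\Phi^{n}=\Phi\gamma$ (where $\Phi^n$ is the $n$-adjacent flag of $\Phi$).
   Context: An $n$-premaniplex is a graph (semi-edges and parallel edges allowed, no loops) whose vertices, called flags, carry a proper edge colouring with colours $0,\dots,n-1$, every flag $\Phi$ having exactly one incident dart of each colour $i$, whose other end is denoted $r_i\Phi$ or $\Phi^i$; it is required that $r_ir_jr_ir_j\Phi=\Phi$ whenever $|i-j|>1$. An $n$-maniplex is a connected $n$-premaniplex in which the permutations $r_i$ and $r_ir_j$ ($i\ne j$) have no fixed points. Facets are the connected components after deleting all edges of colour $n-1$ (for an $(n+1)$-maniplex, colour $n$). Automorphisms are colour-preserving graph automorphisms acting on the right; $\Gamma(\mathcal M)$ is the automorphism group. A canonical Cayley extender $(\mathcal K,\xi)$ consists of an $n$-maniplex $\mathcal K$ and a function $\xi$ from the set of facets of $\mathcal K$ to a group $G$ with $\xi(F)=\xi(F)^{-1}$ for all $F$ (i.e. values are involutions or trivial); it is assumed that $\{\xi(F)\}$ generates $G$ and that $\xi(F)\ne1$ for every facet $F$. The derived maniplex $\mathcal K^\xi$ has flags $(\Phi,\gamma)$ with $\Phi$ a flag of $\mathcal K$ and $\gamma\in G$; for $i<n$, $(\Phi,\gamma)$ is $i$-adjacent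 to $(r_i\Phi,\gamma)$, and it is $n$-adjacent to $(\Phi,\xi(F)\gamma)$, where $F$ is the facet of $\mathcal K$ containing $\Phi$. *)

theory Defs
  imports "HOL-Algebra.Generated_Groups"
begin

text \<open>
  A graph with semi-edges but no loops, whose edges are properly coloured so that every flag has
  exactly one dart of each colour, is the same thing as a family of involutory maps on its flags:
  \<open>adj M i \<Phi>\<close> is the other end of the dart of colour \<open>i\<close> at \<open>\<Phi>\<close>, semi-edges are fixed points, and
  parallel edges are coincidences \<open>adj M i \<Phi> = adj M j \<Phi>\<close>.  For an \<open>n\<close>-premaniplex only the
  colours \<open>i < n\<close> and the values of \<open>adj\<close> on flags are meaningful.
\<close>

record 'a flag_graph =
  flags :: "'a set"
  adj :: "nat \<Rightarrow> 'a \<Rightarrow> 'a"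

definition premaniplex :: "nat \<Rightarrow> 'a flag_graph \<Rightarrow> bool" where
  "premaniplex n M \<longleftrightarrow>
     (\<forall>i<n. \<forall>\<Phi>\<in>flags M. adj M i \<Phi> \<in> flags M \<and> adj M i (adj M i \<Phi>) = \<Phi>) \<and>
     (\<forall>i<n. \<forall>j<n. \<bar>int i - int j\<bar> > 1 \<longrightarrow>
        (\<forall>\<Phi>\<in>flags M. adj M i (adj M j (adj M i (adj M j \<Phi>))) = \<Phi>))"

definition coloured_edges :: "nat set \<Rightarrow> 'a flag_graph \<Rightarrow> ('a \<times> 'a) set" where
  "coloured_edges C M = {(\<Phi>, adj M i \<Phi>) | \<Phi> i. \<Phi> \<in> flags M \<and> i \<in> C}"

definition component :: "nat set \<Rightarrow> 'a flag_graph \<Rightarrow> 'a \<Rightarrow> 'a set" where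
  "component C M \<Phi> = (coloured_edges C M)\<^sup>* `` {\<Phi>}"

definition connected_graph :: "nat \<Rightarrow> 'a flag_graph \<Rightarrow> bool" where
  "connected_graph n M \<longleftrightarrow> flags M \<noteq> {} \<and> (\<forall>\<Phi>\<in>flags M. component {..<n} M \<Phi> = flags M)"

definition maniplex :: "nat \<Rightarrow> 'a flag_graph \<Rightarrow> bool" where
  "maniplex n M \<longleftrightarrow>
     premaniplex n M \<and> connected_graph n M \<and>
     (\<forall>i<n. \<forall>\<Phi>\<in>flags M. adj M i \<Phi> \<noteq> \<Phi>) \<and>
     (\<forall>i<n. \<forall>j<n. i \<noteq> j \<longrightarrow> (\<forall>\<Phi>\<in>flags M. adj M i (adj M j \<Phi>) \<noteq> \<Phi>))"

definition facet_of :: "nat \<Rightarrow> 'a flag_graph \<Rightarrow> 'a \<Rightarrow> 'a set" where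
  "facet_of n M = component ({..<n} - {n - 1}) M"

definition facets :: "nat \<Rightarrow> 'a flag_graph \<Rightarrow> 'a set set" where
  "facets n M = facet_of n M ` flags M"

definition maniplex_iso :: "nat \<Rightarrow> 'a flag_graph \<Rightarrow> 'b flag_graph \<Rightarrow> ('a \<Rightarrow> 'b) \<Rightarrow> bool" where
  "maniplex_iso n M N f \<longleftrightarrow>
     bij_betw f (flags M) (flags N) \<and>
     (\<forall>i<n. \<forall>\<Phi>\<in>flags M. f (adj M i \<Phi>) = adj N i (f \<Phi>))"

definition isomorphic :: "nat \<Rightarrow> 'a flag_graph \<Rightarrow> 'b flag_graph \<Rightarrow> bool" where
  "isomorphic n M N \<longleftrightarrow> (\<exists>f. maniplex_iso n M N f)"

text \<open>
  Automorphisms act on the right, so the product \<open>\<gamma>\<delta>\<close> applies \<open>\<gamma>\<close> first.  They are represented by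
  functions that are \<open>undefined\<close> off the flags, so that equality is equality of automorphisms.
\<close>

definition aut_group :: "nat \<Rightarrow> 'a flag_graph \<Rightarrow> ('a \<Rightarrow> 'a) monoid" where
  "aut_group n M =
     \<lparr>carrier = {\<gamma> \<in> extensional (flags M). maniplex_iso n M M \<gamma>},
      mult = (\<lambda>\<gamma> \<delta>. compose (flags M) \<delta> \<gamma>),
      one = (\<lambda>\<Phi>\<in>flags M. \<Phi>)\<rparr>"

definition regular_on_facets :: "nat \<Rightarrow> 'a flag_graph \<Rightarrow> ('a \<Rightarrow> 'a) set \<Rightarrow> bool" where
  "regular_on_facets n M G \<longleftrightarrow>
     (\<forall>F\<in>facets n M. \<forall>F'\<in>facets n M. \<exists>!\<gamma>. \<gamma> \<in> G \<and> \<gamma> ` F = F')"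

definition canonical_cayley_extender ::
    "nat \<Rightarrow> 'a flag_graph \<Rightarrow> 'g monoid \<Rightarrow> ('a set \<Rightarrow> 'g) \<Rightarrow> bool" where
  "canonical_cayley_extender n K G \<xi> \<longleftrightarrow>
     maniplex n K \<and> group G \<and> \<xi> \<in> facets n K \<rightarrow> carrier G \<and>
     (\<forall>F\<in>facets n K. \<xi> F = inv\<^bsub>G\<^esub> (\<xi> F)) \<and>
     generate G (\<xi> ` facets n K) = carrier G \<and>
     (\<forall>F\<in>facets n K. \<xi> F \<noteq> \<one>\<^bsub>G\<^esub>)"

text \<open>The \<open>else\<close> branch is colour \<open>n\<close>; larger colours do not occur in an \<open>(n+1)\<close>-maniplex.\<close>

definition derived_maniplex ::
    "nat \<Rightarrow> 'a flag_graph \<Rightarrow> 'g monoid \<Rightarrow> ('a set \<Rightarrow> 'g) \<Rightarrow> ('a \<times> 'g) flag_graph" where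
  "derived_maniplex n K G \<xi> =
     \<lparr>flags = flags K \<times> carrier G,
      adj = (\<lambda>i (\<Phi>, \<gamma>). if i < n then (adj K i \<Phi>, \<gamma>)
                         else (\<Phi>, \<xi> (facet_of n K \<Phi>) \<otimes>\<^bsub>G\<^esub> \<gamma>))\<rparr>"

end

(* Right multiplication by G on the second coordinate of K^xi is a group of automorphisms that is
   regular on facets, because a facet of K^xi is a fibre flags K x {gamma}, and the n-neighbour of
   (Phi, gamma) is the image of (Phi, gamma) under gamma^-1 xi(F) gamma.

   Conversely, let K be one facet of M and G a group as in the theorem.  As G is regular on facets,
   (Phi, gamma) |-> Phi gamma is a bijection from K x G to the flags of M, and r_n Phi = Phi gamma
   determines gamma =: xi(Phi).  Since r_n commutes with r_i for i < n - 1, xi is constant on the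
   facets of K; connectedness of M says that the values of xi generate G. *)

theory Submission imports Defs
begin

section \<open>Components and isomorphisms\<close>

lemma component_self: "\<Phi> \<in> component C M \<Phi>"
  by (simp add: component_def)

lemma component_step:
  assumes "\<Psi> \<in> component C M \<Phi>" "\<Psi> \<in> flags M" "i \<in> C"
  shows "adj M i \<Psi> \<in> component C M \<Phi>"
proof -
  have "(\<Psi>, adj M i \<Psi>) \<in> coloured_edges C M"
    using assms by (auto simp: coloured_edges_def)
  with assms(1) show ?thesis
    by (auto simp: component_def intro: rtrancl_into_rtrancl)
qed

text \<open>Induction along a path. The step case may assume that \<open>\<Psi>\<close> is a flag
  because coloured edges start at flags only.\<close>

lemma component_induct [consumes 1, case_names base step]:
  assumes "\<Psi> \<in> component C M \<Phi>"
    and "P \<Phi>"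
    and "\<And>i \<Psi>. \<lbrakk>\<Psi> \<in> component C M \<Phi>; \<Psi> \<in> flags M; i \<in> C; P \<Psi>\<rbrakk> \<Longrightarrow> P (adj M i \<Psi>)"
  shows "P \<Psi>"
proof -
  from assms(1) have "(\<Phi>, \<Psi>) \<in> (coloured_edges C M)\<^sup>*"
    by (simp add: component_def)
  then show ?thesis
  proof (induction rule: rtrancl_induct)
    case base
    show ?case by (rule assms(2))
  next
    case (step \<Psi> \<Psi>')
    then show ?case
      using assms(3) by (auto simp: coloured_edges_def component_def)
  qed
qed

lemma premaniplexD:
  assumes "premaniplex n M" "i < n" "\<Phi> \<in> flags M"
  shows "adj M i \<Phi> \<in> flags M" "adj M i (adj M i \<Phi>) = \<Phi>"
  using assms by (auto simp: premaniplex_def)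

text \<open>Evaluate the defining relation at \<open>adj M j (adj M i \<Phi>)\<close>: all but the
  two outermost adjacencies on the left cancel as involutions.\<close>

lemma premaniplex_commute:
  assumes M: "premaniplex n M" and "i < n" "j < n" "\<bar>int i - int j\<bar> > 1" "\<Phi> \<in> flags M"
  shows "adj M i (adj M j \<Phi>) = adj M j (adj M i \<Phi>)"
proof -
  have "adj M i (adj M j (adj M i (adj M j (adj M j (adj M i \<Phi>))))) = adj M j (adj M i \<Phi>)"
    using assms unfolding premaniplex_def by blast
  then show ?thesis
    using assms by (simp add: premaniplexD[OF M])
qed

lemma component_subset:
  assumes "premaniplex n M" "C \<subseteq> {..<n}" "\<Phi> \<in> flags M"
  shows "component C M \<Phi> \<subseteq> flags M"
proof
  fix \<Psi> assume "\<Psi> \<in> component C M \<Phi>"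
  then show "\<Psi> \<in> flags M"
    by (induction rule: component_induct) (use assms in \<open>auto intro: premaniplexD(1)\<close>)
qed

lemma component_trans:
  assumes "\<Psi> \<in> component C M \<Phi>" "\<Theta> \<in> component C M \<Psi>"
  shows "\<Theta> \<in> component C M \<Phi>"
  using assms by (auto simp: component_def)

text \<open>Each edge can be walked back because its adjacency is an involution.\<close>

lemma component_sym:
  assumes "premaniplex n M" "C \<subseteq> {..<n}" "\<Phi> \<in> flags M" "\<Psi> \<in> component C M \<Phi>"
  shows "\<Phi> \<in> component C M \<Psi>"
  using assms(4)
proof (induction rule: component_induct)
  case base
  show ?case by (rule component_self)
next
  case (step i \<Psi>)
  then have i: "i < n" using assms(2) by auto
  have "adj M i (adj M i \<Psi>) \<in> component C M (adj M i \<Psi>)"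
    using step by (intro component_step component_self premaniplexD(1)[OF assms(1) i]) auto
  then show ?case
    using step by (metis component_trans premaniplexD(2)[OF assms(1) i])
qed

lemma component_eq_iff:
  assumes "premaniplex n M" "C \<subseteq> {..<n}" "\<Phi> \<in> flags M" "\<Psi> \<in> flags M"
  shows "component C M \<Psi> = component C M \<Phi> \<longleftrightarrow> \<Psi> \<in> component C M \<Phi>"
  using component_sym[OF assms(1,2,3)] component_self component_trans
  by (metis subsetI subset_antisym)

section \<open>Isomorphisms and their action on components\<close>

lemma maniplex_isoD:
  assumes "maniplex_iso n M N f"
  shows "bij_betw f (flags M) (flags N)"
    and "\<And>\<Phi>. \<Phi> \<in> flags M \<Longrightarrow> f \<Phi> \<in> flags N"
    and "\<And>i \<Phi>. \<lbrakk>i < n; \<Phi> \<in> flags M\<rbrakk> \<Longrightarrow> f (adj M i \<Phi>) = adj N i (f \<Phi>)"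
  using assms by (auto simp: maniplex_iso_def bij_betw_def)

text \<open>Paths are pushed forward by \<open>f\<close>; conversely a path in \<open>N\<close> from
  \<open>f \<Phi>\<close> is lifted step by step, the invariant being that its current end has a
  preimage in the component of \<open>\<Phi>\<close>.\<close>

lemma maniplex_iso_component:
  assumes f: "maniplex_iso n M N f" and M: "premaniplex n M" and C: "C \<subseteq> {..<n}"
    and \<Phi>: "\<Phi> \<in> flags M"
  shows "f ` component C M \<Phi> = component C N (f \<Phi>)"
proof (intro subset_antisym subsetI)
  fix X assume "X \<in> f ` component C M \<Phi>"
  then obtain \<Psi> where "\<Psi> \<in> component C M \<Phi>" and X: "X = f \<Psi>" by auto
  then have "f \<Psi> \<in> component C N (f \<Phi>)"
  proof (induction arbitrary: X rule: component_induct)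
    case base
    show ?case by (rule component_self)
  next
    case (step i \<Psi>)
    then show ?case
      using C component_step[of "f \<Psi>" C N "f \<Phi>" i] maniplex_isoD[OF f] by auto
  qed
  then show "X \<in> component C N (f \<Phi>)" by (simp add: X)
next
  fix X assume "X \<in> component C N (f \<Phi>)"
  then show "X \<in> f ` component C M \<Phi>"
  proof (induction rule: component_induct)
    case base
    show ?case by (simp add: component_self)
  next
    case (step i X)
    then obtain \<Psi> where \<Psi>: "\<Psi> \<in> component C M \<Phi>" "X = f \<Psi>" by auto
    with component_subset[OF M C \<Phi>] have "\<Psi> \<in> flags M" by auto
    then show ?case
      using \<Psi> step C component_step[OF \<Psi>(1)] maniplex_isoD(3)[OF f, of i \<Psi>] by force
  qed
qed

text \<open>Closure under adjacency stands in place of \<open>premaniplex\<close> because the lemma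
  is also applied to the derived maniplex, for which only closure is established.\<close>

lemma maniplex_iso_inv_into:
  assumes f: "maniplex_iso n M N f"
    and M: "\<And>i \<Phi>. \<lbrakk>i < n; \<Phi> \<in> flags M\<rbrakk> \<Longrightarrow> adj M i \<Phi> \<in> flags M"
  shows "maniplex_iso n N M (inv_into (flags M) f)"
  unfolding maniplex_iso_def
proof (intro conjI allI impI ballI)
  let ?g = "inv_into (flags M) f"
  show g: "bij_betw ?g (flags N) (flags M)"
    by (rule bij_betw_inv_into[OF maniplex_isoD(1)[OF f]])
  fix i X assume "i < n" "X \<in> flags N"
  moreover from this g have "?g X \<in> flags M" by (auto simp: bij_betw_def)
  moreover have "f (?g X) = X"
    using \<open>X \<in> flags N\<close> bij_betw_inv_into_right[OF maniplex_isoD(1)[OF f]] by blast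
  ultimately show "?g (adj N i X) = adj M i (?g X)"
    using maniplex_isoD(3)[OF f, of i "?g X"] M[of i "?g X"]
      bij_betw_inv_into_left[OF maniplex_isoD(1)[OF f], of "adj M i (?g X)"] by auto
qed

lemma maniplex_iso_comp:
  assumes f: "maniplex_iso n L M f" and g: "maniplex_iso n M N g"
  shows "maniplex_iso n L N (g \<circ> f)"
  using bij_betw_trans[OF maniplex_isoD(1)[OF f] maniplex_isoD(1)[OF g]]
  by (auto simp: maniplex_iso_def[of _ L N] maniplex_isoD[OF f] maniplex_isoD[OF g])

text \<open>Automorphisms are extensional, so composites and inverses have to be restricted to the
  flags; this transfers the isomorphism property to the restriction.\<close>

lemma maniplex_iso_cong:
  assumes "maniplex_iso n M N f" "premaniplex n M" "\<And>\<Phi>. \<Phi> \<in> flags M \<Longrightarrow> f \<Phi> = g \<Phi>"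
  shows "maniplex_iso n M N g"
  using assms bij_betw_cong[of "flags M" f g] by (auto simp: maniplex_iso_def premaniplexD(1))

section \<open>The automorphism group and its action on facets\<close>

lemma group_aut_group:
  assumes M: "premaniplex n M"
  shows "group (aut_group n M)"
proof (rule groupI)
  have id: "maniplex_iso n M M (\<lambda>\<Phi>\<in>flags M. \<Phi>)"
    by (rule maniplex_iso_cong[OF _ M, of M id]) (auto simp: maniplex_iso_def)
  then show "\<one>\<^bsub>aut_group n M\<^esub> \<in> carrier (aut_group n M)"
    by (simp add: aut_group_def)
  fix x assume x: "x \<in> carrier (aut_group n M)"
  then have x': "x \<in> extensional (flags M)" "maniplex_iso n M M x"
    by (auto simp: aut_group_def)
  show "\<one>\<^bsub>aut_group n M\<^esub> \<otimes>\<^bsub>aut_group n M\<^esub> x = x"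
    using x' by (auto simp: aut_group_def compose_def extensional_def)
  let ?y = "restrict (inv_into (flags M) x) (flags M)"
  have "maniplex_iso n M M ?y"
    by (rule maniplex_iso_cong[OF maniplex_iso_inv_into[OF x'(2) premaniplexD(1)[OF M]] M]) auto
  moreover have "compose (flags M) x ?y = (\<lambda>\<Phi>\<in>flags M. \<Phi>)"
    using bij_betw_inv_into_right[OF maniplex_isoD(1)[OF x'(2)]]
    by (auto simp: compose_def fun_eq_iff)
  ultimately show "\<exists>y\<in>carrier (aut_group n M). y \<otimes>\<^bsub>aut_group n M\<^esub> x = \<one>\<^bsub>aut_group n M\<^esub>"
    by (intro bexI[of _ ?y]) (auto simp: aut_group_def)
next
  fix x y
  assume "x \<in> carrier (aut_group n M)" "y \<in> carrier (aut_group n M)"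
  then have xy: "maniplex_iso n M M x" "maniplex_iso n M M y"
    by (auto simp: aut_group_def)
  have "maniplex_iso n M M (compose (flags M) y x)"
    by (rule maniplex_iso_cong[OF maniplex_iso_comp[OF xy] M]) (auto simp: compose_def)
  then show "x \<otimes>\<^bsub>aut_group n M\<^esub> y \<in> carrier (aut_group n M)"
    by (auto simp: aut_group_def)
  fix z
  show "x \<otimes>\<^bsub>aut_group n M\<^esub> y \<otimes>\<^bsub>aut_group n M\<^esub> z = x \<otimes>\<^bsub>aut_group n M\<^esub> (y \<otimes>\<^bsub>aut_group n M\<^esub> z)"
    using maniplex_isoD(2)[OF xy(1)]
    by (auto simp: aut_group_def compose_def fun_eq_iff)
qed

text \<open>Deleting the top colour \<open>n\<close> leaves all the colours of an n-maniplex, so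
  facets become the components that express connectedness in rank \<open>n\<close>.\<close>

lemma facet_of_Suc: "facet_of (Suc n) M = component {..<n} M"
proof -
  have "{..<Suc n} - {Suc n - 1} = {..<n}" by auto
  then show ?thesis by (simp add: facet_of_def)
qed

lemma aut_image_facet:
  assumes "premaniplex (Suc n) M" "maniplex_iso (Suc n) M M \<gamma>" "\<Phi> \<in> flags M"
  shows "\<gamma> ` facet_of (Suc n) M \<Phi> = facet_of (Suc n) M (\<gamma> \<Phi>)"
  unfolding facet_of_Suc using assms by (intro maniplex_iso_component) auto

section \<open>The derived maniplex\<close>

text \<open>Colours below \<open>n\<close> fix the second coordinate, and since \<open>K\<close> is
  connected, its paths copied at height \<open>\<gamma>\<close> reach the whole fibre.\<close>

lemma facet_of_derived:
  assumes K: "maniplex n K" and \<Phi>: "\<Phi> \<in> flags K" and \<gamma>: "\<gamma> \<in> carrier G"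
  shows "facet_of (Suc n) (derived_maniplex n K G \<xi>) (\<Phi>, \<gamma>) = flags K \<times> {\<gamma>}"
    (is "_ = ?R")
proof -
  let ?D = "derived_maniplex n K G \<xi>"
  have pre: "premaniplex n K" and con: "component {..<n} K \<Phi> = flags K"
    using K \<Phi> by (auto simp: maniplex_def connected_graph_def)
  have "X \<in> ?R" if "X \<in> component {..<n} ?D (\<Phi>, \<gamma>)" for X
    using that
  proof (induction rule: component_induct)
    case base
    show ?case using \<Phi> by simp
  next
    case (step i X)
    then show ?case by (auto simp: derived_maniplex_def intro: premaniplexD(1)[OF pre])
  qed
  moreover have "(\<Psi>, \<gamma>) \<in> component {..<n} ?D (\<Phi>, \<gamma>)" if "\<Psi> \<in> component {..<n} K \<Phi>" for \<Psi>
    using that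
  proof (induction rule: component_induct)
    case base
    show ?case by (rule component_self)
  next
    case (step i \<Psi>)
    then have "adj ?D i (\<Psi>, \<gamma>) \<in> component {..<n} ?D (\<Phi>, \<gamma>)"
      using \<gamma> by (intro component_step) (auto simp: derived_maniplex_def)
    then show ?case using step by (simp add: derived_maniplex_def)
  qed
  ultimately show ?thesis
    unfolding facet_of_Suc using con by auto
qed

text \<open>Right multiplications are carried over to \<open>M\<close> along the isomorphism; the
  required subgroup is the image of the resulting homomorphism \<open>\<rho>\<close>.\<close>

lemma regular_subgroup_of_derived:
  fixes M :: "'a flag_graph" and K :: "'k flag_graph" and H :: "'g monoid"
  assumes M: "maniplex (Suc n) M" and ext: "canonical_cayley_extender n K H \<xi>"
    and iso: "isomorphic (Suc n) M (derived_maniplex n K H \<xi>)"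
  shows "\<exists>G. subgroup G (aut_group (Suc n) M) \<and> regular_on_facets (Suc n) M G \<and>
    (\<forall>\<Phi>\<in>flags M. \<exists>\<gamma>\<in>G. adj M n \<Phi> = \<gamma> \<Phi>)"
proof -
  let ?D = "derived_maniplex n K H \<xi>"
  have pre: "premaniplex (Suc n) M" using M by (simp add: maniplex_def)
  interpret H: group H using ext by (simp add: canonical_cayley_extender_def)
  have K: "maniplex n K" and \<xi>: "\<And>\<Phi>. \<Phi> \<in> flags K \<Longrightarrow> \<xi> (facet_of n K \<Phi>) \<in> carrier H"
    using ext by (auto simp: canonical_cayley_extender_def facets_def)
  from iso obtain f where f: "maniplex_iso (Suc n) M ?D f"
    by (auto simp: isomorphic_def)
  define g where "g = inv_into (flags M) f"
  have g: "maniplex_iso (Suc n) ?D M g"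
    unfolding g_def by (rule maniplex_iso_inv_into[OF f premaniplexD(1)[OF pre]])
  have gf: "g (f \<Phi>) = \<Phi>" if "\<Phi> \<in> flags M" for \<Phi>
    using bij_betw_inv_into_left[OF maniplex_isoD(1)[OF f] that] by (simp add: g_def)
  have fg: "f (g X) = X" if "X \<in> flags ?D" for X
    using bij_betw_inv_into_right[OF maniplex_isoD(1)[OF f] that] by (simp add: g_def)
  have flagsD: "flags ?D = flags K \<times> carrier H" by (simp add: derived_maniplex_def)
  \<comment> \<open>Voltages multiply on the left and \<open>R \<delta>\<close> on the right, so by
    associativity \<open>R \<delta>\<close> respects colour \<open>n\<close>; the other colours do
    not touch the second coordinate.\<close>
  define R where "R \<delta> = (\<lambda>(\<Phi> :: 'k, \<gamma>). (\<Phi>, \<gamma> \<otimes>\<^bsub>H\<^esub> \<delta>))" for \<delta>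
  have R: "maniplex_iso (Suc n) ?D ?D (R \<delta>)" if \<delta>: "\<delta> \<in> carrier H" for \<delta>
    unfolding maniplex_iso_def
  proof (intro conjI allI impI ballI)
    show "bij_betw (R \<delta>) (flags ?D) (flags ?D)"
      by (rule bij_betw_byWitness[of _ "R (inv\<^bsub>H\<^esub> \<delta>)"])
        (use \<delta> in \<open>auto simp: flagsD R_def H.m_assoc\<close>)
    fix i X assume "X \<in> flags ?D"
    then show "R \<delta> (adj ?D i X) = adj ?D i (R \<delta> X)"
      using \<delta> \<xi> by (auto simp: flagsD R_def derived_maniplex_def H.m_assoc)
  qed
  \<comment> \<open>The conjugate of \<open>R \<delta>\<close> by \<open>f\<close>, cut down to the
    flags so that it is extensional.\<close>
  define \<rho> where "\<rho> \<delta> = restrict (g \<circ> (R \<delta> \<circ> f)) (flags M)" for \<delta>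
  have \<rho>: "maniplex_iso (Suc n) M M (\<rho> \<delta>)" if \<delta>: "\<delta> \<in> carrier H" for \<delta>
    by (rule maniplex_iso_cong[OF maniplex_iso_comp[OF maniplex_iso_comp[OF f R[OF \<delta>]] g] pre])
      (simp add: \<rho>_def)
  have f\<rho>: "f (\<rho> \<delta> \<Phi>) = R \<delta> (f \<Phi>)" if "\<delta> \<in> carrier H" "\<Phi> \<in> flags M" for \<delta> \<Phi>
    using that by (simp add: \<rho>_def fg maniplex_isoD(2)[OF f] maniplex_isoD(2)[OF R])
  have f_mem: "fst (f \<Phi>) \<in> flags K" "snd (f \<Phi>) \<in> carrier H" if "\<Phi> \<in> flags M" for \<Phi>
    using maniplex_isoD(2)[OF f that] by (auto simp: flagsD)
  \<comment> \<open>The product of automorphisms applies the left factor first, which makes right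
    multiplication a homomorphism and not an antihomomorphism.\<close>
  have hom: "group_hom H (aut_group (Suc n) M) \<rho>"
  proof (intro group_hom.intro H.is_group group_aut_group[OF pre] group_hom_axioms.intro homI)
    fix \<delta> assume \<delta>: "\<delta> \<in> carrier H"
    then show "\<rho> \<delta> \<in> carrier (aut_group (Suc n) M)"
      using \<rho>[OF \<delta>] by (simp add: aut_group_def \<rho>_def)
    fix \<epsilon> assume \<epsilon>: "\<epsilon> \<in> carrier H"
    have "\<rho> (\<delta> \<otimes>\<^bsub>H\<^esub> \<epsilon>) \<Phi> = \<rho> \<epsilon> (\<rho> \<delta> \<Phi>)" if \<Phi>: "\<Phi> \<in> flags M" for \<Phi>
    proof -
      have "R (\<delta> \<otimes>\<^bsub>H\<^esub> \<epsilon>) (f \<Phi>) = R \<epsilon> (R \<delta> (f \<Phi>))"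
        using f_mem[OF \<Phi>] \<delta> \<epsilon> by (auto simp: R_def H.m_assoc split: prod.split)
      then show ?thesis
        using \<Phi> f\<rho>[OF \<delta> \<Phi>] maniplex_isoD(2)[OF \<rho>[OF \<delta>] \<Phi>]
        unfolding \<rho>_def[of "\<delta> \<otimes>\<^bsub>H\<^esub> \<epsilon>"] \<rho>_def[of \<epsilon>] by simp
    qed
    then show "\<rho> (\<delta> \<otimes>\<^bsub>H\<^esub> \<epsilon>) = \<rho> \<delta> \<otimes>\<^bsub>aut_group (Suc n) M\<^esub> \<rho> \<epsilon>"
      by (auto simp: aut_group_def compose_def fun_eq_iff \<rho>_def[of "\<delta> \<otimes>\<^bsub>H\<^esub> \<epsilon>"])
  qed
  \<comment> \<open>Under \<open>f\<close> the facets of \<open>M\<close> are fibres, so each is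
    labelled by one element of \<open>H\<close>.\<close>
  have facet_eq: "facet_of (Suc n) M \<Phi> = facet_of (Suc n) M \<Psi> \<longleftrightarrow> snd (f \<Phi>) = snd (f \<Psi>)"
    if "\<Phi> \<in> flags M" "\<Psi> \<in> flags M" for \<Phi> \<Psi>
  proof -
    have img: "f ` facet_of (Suc n) M \<Phi> = flags K \<times> {snd (f \<Phi>)}" if "\<Phi> \<in> flags M" for \<Phi>
    proof -
      have "f ` facet_of (Suc n) M \<Phi> = facet_of (Suc n) ?D (f \<Phi>)"
        unfolding facet_of_Suc by (intro maniplex_iso_component[OF f pre]) (use that in auto)
      then show ?thesis
        using facet_of_derived[OF K f_mem[OF that], of \<xi>] by simp
    qed
    have sub: "facet_of (Suc n) M \<Phi> \<subseteq> flags M" if "\<Phi> \<in> flags M" for \<Phi>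
      unfolding facet_of_Suc by (intro component_subset[OF pre]) (use that in auto)
    have "inj_on f (flags M)" using maniplex_isoD(1)[OF f] by (simp add: bij_betw_def)
    from inj_on_image_eq_iff[OF this sub sub] that img f_mem show ?thesis
      by (metis mem_Sigma_iff singletonD singletonI)
  qed
  have "regular_on_facets (Suc n) M (\<rho> ` carrier H)"
    unfolding regular_on_facets_def
  proof (intro ballI)
    fix F F' assume "F \<in> facets (Suc n) M" "F' \<in> facets (Suc n) M"
    then obtain \<Phi> \<Psi> where F: "\<Phi> \<in> flags M" "F = facet_of (Suc n) M \<Phi>"
      and F': "\<Psi> \<in> flags M" "F' = facet_of (Suc n) M \<Psi>"
      by (auto simp: facets_def)
    \<comment> \<open>On the labels the action is right translation of \<open>H\<close> on itself,
      where exactly one \<open>\<delta>\<close> solves the equation.\<close>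
    have iff: "\<rho> \<delta> ` F = F' \<longleftrightarrow> snd (f \<Phi>) \<otimes>\<^bsub>H\<^esub> \<delta> = snd (f \<Psi>)" if \<delta>: "\<delta> \<in> carrier H" for \<delta>
      using facet_eq[OF maniplex_isoD(2)[OF \<rho>[OF \<delta>] F(1)] F'(1)] f\<rho>[OF \<delta> F(1)]
      by (simp add: F F' aut_image_facet[OF pre \<rho>[OF \<delta>]] R_def split_beta)
    let ?\<delta> = "inv\<^bsub>H\<^esub> (snd (f \<Phi>)) \<otimes>\<^bsub>H\<^esub> snd (f \<Psi>)"
    have \<delta>: "?\<delta> \<in> carrier H" using f_mem F F' by simp
    have "\<rho> ?\<delta> ` F = F'"
      unfolding iff[OF \<delta>] using f_mem F F' by (simp add: H.m_assoc[symmetric])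
    moreover have "\<epsilon> = ?\<delta>" if "\<epsilon> \<in> carrier H" "\<rho> \<epsilon> ` F = F'" for \<epsilon>
      using iff[OF that(1)] that f_mem[OF F(1)] f_mem[OF F'(1)] by (metis H.inv_solve_left')
    ultimately show "\<exists>!\<gamma>. \<gamma> \<in> \<rho> ` carrier H \<and> \<gamma> ` F = F'"
      using \<delta> by (intro ex1I[of _ "\<rho> ?\<delta>"]) (blast, metis imageE)
  qed
  moreover have "\<exists>\<gamma>\<in>\<rho> ` carrier H. adj M n \<Phi> = \<gamma> \<Phi>" if \<Phi>: "\<Phi> \<in> flags M" for \<Phi>
  proof -
    obtain \<Theta> \<gamma> where \<Theta>: "f \<Phi> = (\<Theta>, \<gamma>)" "\<Theta> \<in> flags K" "\<gamma> \<in> carrier H"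
      using f_mem[OF \<Phi>] by (metis prod.collapse)
    let ?x = "\<xi> (facet_of n K \<Theta>)"
    let ?\<delta> = "inv\<^bsub>H\<^esub> \<gamma> \<otimes>\<^bsub>H\<^esub> (?x \<otimes>\<^bsub>H\<^esub> \<gamma>)"
    have \<delta>: "?\<delta> \<in> carrier H" using \<Theta> \<xi> by simp
    have "f (adj M n \<Phi>) = (\<Theta>, ?x \<otimes>\<^bsub>H\<^esub> \<gamma>)"
      using maniplex_isoD(3)[OF f _ \<Phi>, of n] \<Theta> by (simp add: derived_maniplex_def)
    also have "\<dots> = f (\<rho> ?\<delta> \<Phi>)"
      unfolding f\<rho>[OF \<delta> \<Phi>] using \<Theta> \<xi> by (simp add: R_def H.m_assoc[symmetric])
    finally have "adj M n \<Phi> = \<rho> ?\<delta> \<Phi>"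
      using gf[OF premaniplexD(1)[OF pre lessI \<Phi>]] gf[OF maniplex_isoD(2)[OF \<rho>[OF \<delta>] \<Phi>]] by metis
    with \<delta> show ?thesis by blast
  qed
  ultimately show ?thesis
    using group_hom.img_is_subgroup[OF hom] by blast
qed

section \<open>The canonical Cayley extender of a regular group\<close>

text \<open>The extender is built inside \<open>M\<close>: one facet serves as \<open>K\<close> and
  \<open>G\<close> itself as the voltage group, hence the types in the conclusion.\<close>

lemma derived_of_regular_subgroup:
  fixes M :: "'a flag_graph"
  assumes M: "maniplex (Suc n) M" and G: "subgroup G (aut_group (Suc n) M)"
    and reg: "regular_on_facets (Suc n) M G"
    and adj_n: "\<forall>\<Phi>\<in>flags M. \<exists>\<gamma>\<in>G. adj M n \<Phi> = \<gamma> \<Phi>"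
  shows "\<exists>(K :: 'a flag_graph) (H :: ('a \<Rightarrow> 'a) monoid) \<xi>.
    canonical_cayley_extender n K H \<xi> \<and> isomorphic (Suc n) M (derived_maniplex n K H \<xi>)"
proof -
  have pre: "premaniplex (Suc n) M"
    and ne: "flags M \<noteq> {}"
    and con: "\<And>\<Phi>. \<Phi> \<in> flags M \<Longrightarrow> component {..<Suc n} M \<Phi> = flags M"
    and free_n: "\<And>\<Phi>. \<Phi> \<in> flags M \<Longrightarrow> adj M n \<Phi> \<noteq> \<Phi>"
    using M by (auto simp: maniplex_def connected_graph_def)
  define H where "H = (aut_group (Suc n) M)\<lparr>carrier := G\<rparr>"
  interpret H: group H
    unfolding H_def by (rule subgroup.subgroup_is_group[OF G group_aut_group[OF pre]])
  have carrier_H: "carrier H = G" by (simp add: H_def)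
  have aut: "maniplex_iso (Suc n) M M \<gamma>" "\<gamma> \<in> extensional (flags M)" if "\<gamma> \<in> G" for \<gamma>
    using subgroup.subset[OF G] that by (auto simp: aut_group_def)
  note autD = maniplex_isoD(2,3)[OF aut(1)]
  have mult: "(\<gamma> \<otimes>\<^bsub>H\<^esub> \<delta>) \<Phi> = \<delta> (\<gamma> \<Phi>)" if "\<Phi> \<in> flags M" for \<gamma> \<delta> \<Phi>
    using that by (simp add: H_def aut_group_def compose_def)
  have one: "\<one>\<^bsub>H\<^esub> \<Phi> = \<Phi>" if "\<Phi> \<in> flags M" for \<Phi>
    using that by (simp add: H_def aut_group_def)
  have facet_mem: "facet_of (Suc n) M \<Phi> \<in> facets (Suc n) M" if "\<Phi> \<in> flags M" for \<Phi>
    using that by (auto simp: facets_def)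
  have facet_eq: "facet_of (Suc n) M \<Psi> = facet_of (Suc n) M \<Phi> \<longleftrightarrow> \<Psi> \<in> facet_of (Suc n) M \<Phi>"
    if "\<Phi> \<in> flags M" "\<Psi> \<in> flags M" for \<Phi> \<Psi>
    unfolding facet_of_Suc by (rule component_eq_iff[OF pre _ that]) auto
  \<comment> \<open>By regularity an element of \<open>G\<close> is known from the facet to which it
    sends one flag. The equalities in \<open>G\<close> below come down to this.\<close>
  have uniq: "\<gamma> = \<delta>"
    if "\<gamma> \<in> G" "\<delta> \<in> G" "\<Phi> \<in> flags M" "facet_of (Suc n) M (\<gamma> \<Phi>) = facet_of (Suc n) M (\<delta> \<Phi>)"
    for \<gamma> \<delta> \<Phi>
  proof -
    have "\<gamma> ` facet_of (Suc n) M \<Phi> = \<delta> ` facet_of (Suc n) M \<Phi>"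
      using that by (simp add: aut_image_facet[OF pre aut(1)])
    moreover have "\<delta> ` facet_of (Suc n) M \<Phi> \<in> facets (Suc n) M"
      using that by (simp add: aut_image_facet[OF pre aut(1)] facet_mem autD)
    ultimately show ?thesis
      using reg that(1,2) facet_mem[OF that(3)] unfolding regular_on_facets_def by metis
  qed
  obtain \<Phi>\<^sub>0 where \<Phi>\<^sub>0: "\<Phi>\<^sub>0 \<in> flags M" using ne by auto

  \<comment> \<open>The base facet as an n-maniplex\<close>
  define B where "B = facet_of (Suc n) M \<Phi>\<^sub>0"
  have B_sub: "B \<subseteq> flags M"
    unfolding B_def facet_of_Suc by (intro component_subset[OF pre]) (use \<Phi>\<^sub>0 in auto)
  have B_facet: "facet_of (Suc n) M \<Phi> = B" if "\<Phi> \<in> B" for \<Phi>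
    using facet_eq[OF \<Phi>\<^sub>0, of \<Phi>] that B_sub by (auto simp: B_def)
  have B_adj: "adj M i \<Phi> \<in> B" if "\<Phi> \<in> B" "i < n" for \<Phi> i
    using that B_sub unfolding B_def facet_of_Suc by (auto intro: component_step)
  have \<Phi>\<^sub>0_B: "\<Phi>\<^sub>0 \<in> B" by (simp add: B_def facet_of_Suc component_self)
  \<comment> \<open>The adjacencies of \<open>M\<close> are kept; \<open>K\<close> is read with the
    colours below \<open>n\<close> only, under which \<open>B\<close> is closed.\<close>
  define K where "K = M\<lparr>flags := B\<rparr>"
  have flags_K: "flags K = B" and adj_K: "adj K = adj M" by (auto simp: K_def)
  have pre_K: "premaniplex n K"
    using pre B_sub B_adj by (auto simp: premaniplex_def flags_K adj_K subset_iff)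
  have con_K: "component {..<n} K \<Phi> = B" if "\<Phi> \<in> B" for \<Phi>
  proof
    show "component {..<n} K \<Phi> \<subseteq> B"
      using component_subset[OF pre_K, of "{..<n}" \<Phi>] that by (simp add: flags_K)
    show "B \<subseteq> component {..<n} K \<Phi>"
    proof
      fix \<Psi> assume "\<Psi> \<in> B"
      then have "\<Psi> \<in> component {..<n} M \<Phi>"
        using B_facet[OF that] by (simp add: facet_of_Suc)
      \<comment> \<open>Membership in \<open>B\<close> is carried along, since an edge of
        \<open>K\<close> has to start at a flag of \<open>K\<close>.\<close>
      then have "\<Psi> \<in> component {..<n} K \<Phi> \<and> \<Psi> \<in> B"
      proof (induction rule: component_induct)
        case base
        show ?case using that by (simp add: component_self)
      next
        case (step i \<Psi>)
        then show ?case
          using component_step[of \<Psi> "{..<n}" K \<Phi> i] B_adj by (auto simp: flags_K adj_K)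
      qed
      then show "\<Psi> \<in> component {..<n} K \<Phi>" ..
    qed
  qed
  have man_K: "maniplex n K"
    using M pre_K con_K \<Phi>\<^sub>0_B B_sub
    by (auto simp: maniplex_def connected_graph_def flags_K adj_K subset_iff)

  \<comment> \<open>The voltages\<close>
  define v where "v \<Phi> = (THE \<gamma>. \<gamma> \<in> G \<and> adj M n \<Phi> = \<gamma> \<Phi>)" for \<Phi>
  have v_eq: "v \<Phi> = \<gamma>" if "\<Phi> \<in> flags M" "\<gamma> \<in> G" "adj M n \<Phi> = \<gamma> \<Phi>" for \<Phi> \<gamma>
    unfolding v_def
  proof (rule the_equality)
    fix \<delta> assume \<delta>: "\<delta> \<in> G \<and> adj M n \<Phi> = \<delta> \<Phi>"
    then show "\<delta> = \<gamma>" using that by (intro uniq[of \<delta> \<gamma> \<Phi>]) auto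
  qed (use that in auto)
  have v: "v \<Phi> \<in> G" "v \<Phi> \<Phi> = adj M n \<Phi>" if "\<Phi> \<in> flags M" for \<Phi>
    using adj_n v_eq that by metis+
  have v_facet: "v \<Psi> = v \<Phi>" if "\<Phi> \<in> B" "\<Psi> \<in> facet_of n K \<Phi>" for \<Phi> \<Psi>
    using that(2) unfolding facet_of_def
  proof (induction rule: component_induct)
    case (step i \<Psi>)
    \<comment> \<open>A facet of \<open>K\<close> omits colour \<open>n - 1\<close>, so its colours
      differ from \<open>n\<close> by at least 2 and commute with it. Then \<open>v \<Psi>\<close>
      also sends \<open>adj M i \<Psi>\<close> to its n-neighbour.\<close>
    then have i: "i < n" "\<bar>int i - int n\<bar> > 1" and \<Psi>: "\<Psi> \<in> flags M"
      using B_sub by (auto simp: flags_K)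
    have "adj M n (adj M i \<Psi>) = adj M i (adj M n \<Psi>)"
      using premaniplex_commute[OF pre _ _ i(2) \<Psi>] i(1) by simp
    also have "\<dots> = v \<Psi> (adj M i \<Psi>)"
      using autD(2)[OF v(1)[OF \<Psi>], of i \<Psi>] v(2)[OF \<Psi>] i \<Psi> by simp
    finally have "v (adj M i \<Psi>) = v \<Psi>"
      using i by (intro v_eq v(1) premaniplexD(1)[OF pre] \<Psi>) auto
    with step show ?case by (simp add: adj_K)
  qed simp
  \<comment> \<open>Any flag of the facet may be chosen, by \<open>v_facet\<close>.\<close>
  define \<xi> where "\<xi> F = v (SOME \<Phi>. \<Phi> \<in> F)" for F
  have \<xi>: "\<xi> (facet_of n K \<Phi>) = v \<Phi>" if "\<Phi> \<in> B" for \<Phi>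
  proof -
    have "\<Phi> \<in> facet_of n K \<Phi>" by (simp add: facet_of_def component_self)
    then show ?thesis unfolding \<xi>_def by (intro v_facet[OF that] someI)
  qed
  have facets_K: "\<exists>\<Phi>\<in>B. F = facet_of n K \<Phi> \<and> \<xi> F = v \<Phi>" if "F \<in> facets n K" for F
    using that \<xi> by (auto simp: facets_def flags_K)
  \<comment> \<open>An automorphism commutes with colour \<open>n\<close>, so applying
    \<open>v \<Phi>\<close> twice to \<open>\<Phi>\<close> amounts to crossing the n-edge twice; an
    element of \<open>G\<close> fixing a flag is trivial by \<open>uniq\<close>.\<close>
  have v_square: "v \<Phi> \<otimes>\<^bsub>H\<^esub> v \<Phi> = \<one>\<^bsub>H\<^esub>" if "\<Phi> \<in> flags M" for \<Phi>
  proof (rule uniq[OF _ _ that])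
    have "v \<Phi> (v \<Phi> \<Phi>) = adj M n (v \<Phi> \<Phi>)"
      using autD(2)[OF v(1)[OF that] lessI that] v(2)[OF that] by simp
    then have "v \<Phi> (v \<Phi> \<Phi>) = \<Phi>"
      using that v premaniplexD(2)[OF pre lessI] by simp
    then show "facet_of (Suc n) M ((v \<Phi> \<otimes>\<^bsub>H\<^esub> v \<Phi>) \<Phi>) = facet_of (Suc n) M (\<one>\<^bsub>H\<^esub> \<Phi>)"
      using that by (simp add: mult one)
  qed (use H.m_closed[of "v \<Phi>" "v \<Phi>"] H.one_closed v(1)[OF that] in \<open>auto simp: carrier_H\<close>)

  \<comment> \<open>Generation of \<open>G\<close> by the voltages\<close>
  let ?S = "generate H (\<xi> ` facets n K)"
  have S_sub: "?S \<subseteq> G"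
    unfolding carrier_H[symmetric]
    using facets_K v(1) B_sub by (intro H.generate_incl) (auto simp: carrier_H; metis subsetD)
  \<comment> \<open>Induction along a path from the base flag. A colour below \<open>n\<close> moves
    \<open>\<Theta>\<close> within \<open>B\<close>; colour \<open>n\<close> at
    \<open>\<gamma> \<Theta>\<close> keeps \<open>\<Theta>\<close> and multiplies
    \<open>\<gamma>\<close> on the left by the generator \<open>v \<Theta>\<close>.\<close>
  have reach: "\<exists>\<Theta>\<in>B. \<exists>\<gamma>\<in>?S. \<Psi> = \<gamma> \<Theta>" if "\<Psi> \<in> flags M" for \<Psi>
  proof -
    from that con[OF \<Phi>\<^sub>0] have "\<Psi> \<in> component {..<Suc n} M \<Phi>\<^sub>0" by simp
    then show ?thesis
    proof (induction rule: component_induct)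
      case base
      show ?case using \<Phi>\<^sub>0_B one[OF \<Phi>\<^sub>0] generate.one by metis
    next
      case (step i \<Psi>)
      then obtain \<Theta> \<gamma> where \<Theta>: "\<Theta> \<in> B" "\<gamma> \<in> ?S" "\<Psi> = \<gamma> \<Theta>" by auto
      then have \<Theta>': "\<Theta> \<in> flags M" "\<gamma> \<in> G" using B_sub S_sub by auto
      have adj: "adj M i \<Psi> = \<gamma> (adj M i \<Theta>)"
        using autD(2)[OF \<Theta>'(2) _ \<Theta>'(1)] step \<Theta> by auto
      show ?case
      proof (cases "i = n")
        case True
        have "facet_of n K \<Theta> \<in> facets n K"
          using \<Theta>(1) by (simp add: facets_def flags_K)
        then have "v \<Theta> \<in> \<xi> ` facets n K"
          by (metis \<xi>[OF \<Theta>(1)] imageI)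
        then have "v \<Theta> \<otimes>\<^bsub>H\<^esub> \<gamma> \<in> ?S" by (intro generate.eng generate.incl \<Theta>)
        moreover have "adj M i \<Psi> = (v \<Theta> \<otimes>\<^bsub>H\<^esub> \<gamma>) \<Theta>"
          using adj True by (simp add: mult \<Theta>' v)
        ultimately show ?thesis using \<Theta>(1) by blast
      next
        case False
        then show ?thesis using adj \<Theta> B_adj[OF \<Theta>(1), of i] step by auto
      qed
    qed
  qed
  have B_base: "facet_of (Suc n) M (\<delta> \<Theta>) = facet_of (Suc n) M (\<delta> \<Phi>)"
    if "\<delta> \<in> G" "\<Theta> \<in> B" "\<Phi> \<in> B" for \<delta> \<Theta> \<Phi>
    using that B_sub aut_image_facet[OF pre aut(1)[OF that(1)]] B_facet by (metis subsetD)
  \<comment> \<open>Write the image of the base flag under \<open>\<gamma>\<close> as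
    \<open>\<delta> \<Theta>\<close> with \<open>\<delta>\<close> in \<open>?S\<close>. As
    \<open>\<delta>\<close> maps all of \<open>B\<close> into one facet, \<open>\<gamma>\<close> and
    \<open>\<delta>\<close> send the base flag to the same facet and so agree.\<close>
  have "G \<subseteq> ?S"
  proof
    fix \<gamma> assume \<gamma>: "\<gamma> \<in> G"
    then obtain \<Theta> \<delta> where \<Theta>: "\<Theta> \<in> B" "\<delta> \<in> ?S" "\<gamma> \<Phi>\<^sub>0 = \<delta> \<Theta>"
      using reach[OF autD(1)[OF \<gamma> \<Phi>\<^sub>0]] by auto
    have "facet_of (Suc n) M (\<delta> \<Theta>) = facet_of (Suc n) M (\<delta> \<Phi>\<^sub>0)"
      using \<Theta> S_sub \<Phi>\<^sub>0_B by (intro B_base) auto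
    then have "\<gamma> = \<delta>"
      using \<Theta> S_sub by (intro uniq[OF \<gamma> _ \<Phi>\<^sub>0]) auto
    with \<Theta> show "\<gamma> \<in> ?S" by simp
  qed
  with S_sub have gen: "?S = G" by simp
  have ext: "canonical_cayley_extender n K H \<xi>"
    unfolding canonical_cayley_extender_def
  proof (intro conjI man_K H.is_group)
    show "\<xi> \<in> facets n K \<rightarrow> carrier H"
      using facets_K v(1) B_sub by (auto simp: carrier_H; metis subsetD)
    show "?S = carrier H" by (simp add: gen carrier_H)
    show "\<forall>F\<in>facets n K. \<xi> F = inv\<^bsub>H\<^esub> \<xi> F"
    proof
      fix F assume "F \<in> facets n K"
      then obtain \<Phi> where \<Phi>: "\<Phi> \<in> flags M" "\<xi> F = v \<Phi>" using facets_K B_sub by blast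
      then show "\<xi> F = inv\<^bsub>H\<^esub> \<xi> F"
        using H.inv_equality[OF v_square] v(1) by (simp add: carrier_H)
    qed
    \<comment> \<open>A trivial voltage would make some flag of \<open>M\<close> its own
      n-neighbour.\<close>
    show "\<forall>F\<in>facets n K. \<xi> F \<noteq> \<one>\<^bsub>H\<^esub>"
    proof
      fix F assume "F \<in> facets n K"
      then obtain \<Phi> where \<Phi>: "\<Phi> \<in> flags M" "\<xi> F = v \<Phi>" using facets_K B_sub by blast
      then show "\<xi> F \<noteq> \<one>\<^bsub>H\<^esub>" using v(2) one free_n by metis
    qed
  qed

  \<comment> \<open>The isomorphism from the derived maniplex to \<open>M\<close>\<close>
  let ?D = "derived_maniplex n K H \<xi>"
  have flagsD: "flags ?D = B \<times> G" by (simp add: derived_maniplex_def flags_K carrier_H)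
  have h: "maniplex_iso (Suc n) ?D M (\<lambda>(\<Phi>, \<gamma>). \<gamma> \<Phi>)"
    unfolding maniplex_iso_def
  proof (intro conjI allI impI ballI)
    show "bij_betw (\<lambda>(\<Phi>, \<gamma>). \<gamma> \<Phi>) (flags ?D) (flags M)"
      unfolding bij_betw_def
    proof
      have "\<Phi> = \<Psi> \<and> \<gamma> = \<delta>"
        if *: "\<Phi> \<in> B" "\<Psi> \<in> B" "\<gamma> \<in> G" "\<delta> \<in> G" "\<gamma> \<Phi> = \<delta> \<Psi>" for \<Phi> \<Psi> \<gamma> \<delta>
      proof -
        \<comment> \<open>The facet of the image determines the group element; the flag of
          \<open>B\<close> then follows from injectivity of that automorphism.\<close>
        have "facet_of (Suc n) M (\<gamma> \<Phi>) = facet_of (Suc n) M (\<delta> \<Phi>)"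
          unfolding *(5) using * B_base by blast
        then have "\<gamma> = \<delta>" using * B_sub by (intro uniq[of \<gamma> \<delta> \<Phi>]) auto
        moreover have "inj_on \<delta> (flags M)"
          using maniplex_isoD(1)[OF aut(1)] * by (auto simp: bij_betw_def)
        ultimately show ?thesis using * B_sub by (auto dest: inj_onD)
      qed
      then show "inj_on (\<lambda>(\<Phi>, \<gamma>). \<gamma> \<Phi>) (flags ?D)"
        unfolding flagsD by (intro inj_onI) auto
      show "(\<lambda>(\<Phi>, \<gamma>). \<gamma> \<Phi>) ` flags ?D = flags M"
      proof
        show "(\<lambda>(\<Phi>, \<gamma>). \<gamma> \<Phi>) ` flags ?D \<subseteq> flags M"
          using B_sub autD(1) by (auto simp: flagsD)
        show "flags M \<subseteq> (\<lambda>(\<Phi>, \<gamma>). \<gamma> \<Phi>) ` flags ?D"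
          using reach by (force simp: flagsD gen)
      qed
    qed
    fix i X assume i: "i < Suc n" and "X \<in> flags ?D"
    then obtain \<Phi> \<gamma> where X: "X = (\<Phi>, \<gamma>)" "\<Phi> \<in> B" "\<gamma> \<in> G" by (auto simp: flagsD)
    then have \<Phi>: "\<Phi> \<in> flags M" using B_sub by auto
    \<comment> \<open>For colour \<open>n\<close> both sides are
      \<open>\<gamma> (v \<Phi> \<Phi>)\<close>, the left one because the product applies
      \<open>v \<Phi>\<close> first.\<close>
    have "i = n" if "\<not> i < n" using i that by simp
    then show "(\<lambda>(\<Phi>, \<gamma>). \<gamma> \<Phi>) (adj ?D i X) = adj M i ((\<lambda>(\<Phi>, \<gamma>). \<gamma> \<Phi>) X)"
      using autD(2)[OF X(3) i \<Phi>] X \<Phi> v(2)[OF \<Phi>]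
      by (cases "i < n") (auto simp: derived_maniplex_def adj_K \<xi> mult)
  qed
  \<comment> \<open>Closure of the derived maniplex, needed to invert \<open>h\<close>.\<close>
  have "adj ?D i X \<in> flags ?D" if "i < Suc n" "X \<in> flags ?D" for i X
  proof -
    have "v \<Phi> \<otimes>\<^bsub>H\<^esub> \<gamma> \<in> G" if "\<Phi> \<in> B" "\<gamma> \<in> G" for \<Phi> \<gamma>
      using H.m_closed[of "v \<Phi>" \<gamma>] v(1) that B_sub by (auto simp: carrier_H)
    then show ?thesis
      using that B_adj \<xi> by (auto simp: derived_maniplex_def flags_K adj_K carrier_H)
  qed
  from maniplex_iso_inv_into[OF h this] ext show ?thesis
    unfolding isomorphic_def by blast
qed

(* HOL cannot quantify existentially over types.  The first conjunct looks for K on the flag type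
   of M and for the voltage group on the type of permutations of flags; the second conjunct, in
   which 'k and 'g are arbitrary, says that this choice of types loses no generality. *)
theorem theorem3p8:
  fixes M :: "'a flag_graph" and n :: nat
  assumes "maniplex (Suc n) M"
  shows "((\<exists>(K :: 'a flag_graph) (H :: ('a \<Rightarrow> 'a) monoid) \<xi>.
             canonical_cayley_extender n K H \<xi> \<and>
             isomorphic (Suc n) M (derived_maniplex n K H \<xi>))
          \<longleftrightarrow>
          (\<exists>G. subgroup G (aut_group (Suc n) M) \<and>
               regular_on_facets (Suc n) M G \<and>
               (\<forall>\<Phi>\<in>flags M. \<exists>\<gamma>\<in>G. adj M n \<Phi> = \<gamma> \<Phi>)))
         \<and>
         ((\<exists>(K :: 'k flag_graph) (H :: 'g monoid) \<xi>.
             canonical_cayley_extender n K H \<xi> \<and>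
             isomorphic (Suc n) M (derived_maniplex n K H \<xi>))
          \<longrightarrow>
          (\<exists>(K :: 'a flag_graph) (H :: ('a \<Rightarrow> 'a) monoid) \<xi>.
             canonical_cayley_extender n K H \<xi> \<and>
             isomorphic (Suc n) M (derived_maniplex n K H \<xi>)))"
  \<comment> \<open>The first lemma accepts an extender on any types and the second returns one on
    the types of \<open>M\<close>; their composition is the second conjunct.\<close>
  using regular_subgroup_of_derived[OF assms] derived_of_regular_subgroup[OF assms] by meson

end
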